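(* Let $T,D\ge 1$, let $f_1,\dots,f_T:\mathbb{R}^D\to\mathbb{R}^D$ be arbitrary functions, let $s_0\in\mathbb{R}^D$, and let $\mathbf{s}^\star_{1:T}=(s_1^\star,\dots,s_T^\star)$ be the sequence with $s_1^\star=f_1(s_0)$ and $s_t^\star=f_t(s_{t-1}^\star)$ for $2\le t\le T$. Consider an iterative method $\mathbf{s}_{1:T}^{(i+1)}=\mathcal{A}(\mathbf{s}_{1:T}^{(i)})$, $i=0,1,2,\dots$, on $(\mathbb{R}^D)^T$, such that each application of $\mathcal{A}$ takes the form of the linear recursion over $t=1,\dots,T$ $$s_t^{(i+1)}=\tilde{A}_t\, s_{t-1}^{(i+1)}+\left(f_t(s_{t-1}^{(i)})-\tilde{A}_t\, s_{t-1}^{(i)}\right)$$ for arbitrary matrices $\tilde{A}_1,\dots,\tilde{A}_T\in\mathbb{R}^{D\times D}$. Then the iterates converge to $\mathbf{s}^\star_{1:T}$ in at most $T$ iterations, regardless of the initial guess $\mathbf{s}^{(0)}_{1:T}$; that is, $\mathbf{s}^{(i)}_{1:T}=\mathbf{s}^\star_{1:T}$ for all $i\ge T$.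
   Context: The initial condition is fixed and known, so $s_0^{(i)}=s_0$ for every iteration $i$. The matrices $\tilde{A}_t$ may depend on the current iterate $\mathbf{s}^{(i)}_{1:T}$ (so they may differ from one iteration to the next). *)

theory Defs
  imports "HOL-Analysis.Analysis"
begin

(* The space (R^D)^T, with D = CARD('d). Functions in it are undefined off {1..T},
   so equality of two such functions is equality of the sequences (s_1, ..., s_T). *)
definition trajectories :: "nat \<Rightarrow> (nat \<Rightarrow> real ^ 'd) set" where
  "trajectories T = {1..T} \<rightarrow>\<^sub>E UNIV"

(* Prefixes the fixed initial condition: index 0 gives s0, whatever the trajectory is. *)
definition with_init :: "real ^ 'd \<Rightarrow> (nat \<Rightarrow> real ^ 'd) \<Rightarrow> nat \<Rightarrow> real ^ 'd" where
  "with_init s0 x t = (if t = 0 then s0 else x t)"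

(* y is obtained from x by the linear recursion with transition matrices At 1, ..., At T;
   y occurs on both sides, at times t and t - 1. *)
definition linear_recursion ::
  "nat \<Rightarrow> (nat \<Rightarrow> real ^ 'd \<Rightarrow> real ^ 'd) \<Rightarrow> real ^ 'd \<Rightarrow> (nat \<Rightarrow> real ^ 'd ^ 'd)
    \<Rightarrow> (nat \<Rightarrow> real ^ 'd) \<Rightarrow> (nat \<Rightarrow> real ^ 'd) \<Rightarrow> bool" where
  "linear_recursion T f s0 At x y \<longleftrightarrow>
    (\<forall>t\<in>{1..T}. y t = At t *v with_init s0 y (t - 1)
      + (f t (with_init s0 x (t - 1)) - At t *v with_init s0 x (t - 1)))"

end

theory Submission
  imports Defs
begin

text \<open>
  The recursion propagates correctness one time step per iteration. The initial condition is exact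
  in every iterate. If an iterate is exact up to time \<open>n\<close>, then by induction on \<open>t\<close> the next one is
  exact up to time \<open>n + 1\<close>: at each time \<open>t \<le> n + 1\<close> the old and the new state at time \<open>t - 1\<close>
  both equal the true state there, so the two terms involving the transition matrix cancel,
  whatever that matrix is, and what remains is \<open>f t\<close> applied to the true state
  (\<open>linear_recursion_extends_exact_prefix\<close>). Hence iterate \<open>i\<close> is exact up to time \<open>i\<close>, and for
  \<open>i \<ge> T\<close> the exact prefix is the whole trajectory. Since the matrices drop out, they may change
  from one iteration to the next.
\<close>

text \<open>
  The exact prefix is measured on trajectories with the initial condition prefixed, so that time 0
  is always exact and no separate argument is needed for the first iteration.
\<close>

lemma linear_recursion_extends_exact_prefix:
  fixes z :: "nat \<Rightarrow> real ^ 'd"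
  assumes rec: "linear_recursion T f s0 At x y"
    and z: "\<And>t. t \<in> {1..T} \<Longrightarrow> z t = f t (with_init s0 z (t - 1))"
    and x: "\<And>t. \<lbrakk>t \<le> n; t \<le> T\<rbrakk> \<Longrightarrow> with_init s0 x t = with_init s0 z t"
  shows "\<lbrakk>t \<le> Suc n; t \<le> T\<rbrakk> \<Longrightarrow> with_init s0 y t = with_init s0 z t"
proof (induction t)
  case 0
  show ?case by (simp add: with_init_def)
next
  case (Suc t)
  have y_t: "with_init s0 y t = with_init s0 z t"
    using Suc by simp
  have x_t: "with_init s0 x t = with_init s0 z t"
    using Suc.prems x by simp
  have t: "Suc t \<in> {1..T}"
    using Suc.prems by simp
  have "y (Suc t) = At (Suc t) *v with_init s0 y t
      + (f (Suc t) (with_init s0 x t) - At (Suc t) *v with_init s0 x t)"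
    using rec t unfolding linear_recursion_def by (metis diff_Suc_1)
  also have "\<dots> = f (Suc t) (with_init s0 z t)"
    by (simp add: x_t y_t)
  also have "\<dots> = z (Suc t)"
    using z[OF t] by simp
  finally show ?case
    by (simp add: with_init_def)
qed

theorem proposition3p1:
  fixes T :: nat
    and f :: "nat \<Rightarrow> real ^ 'd \<Rightarrow> real ^ 'd"
    and s0 :: "real ^ 'd"
    and sstar :: "nat \<Rightarrow> real ^ 'd"
    and \<A> :: "(nat \<Rightarrow> real ^ 'd) \<Rightarrow> (nat \<Rightarrow> real ^ 'd)"
    and s :: "nat \<Rightarrow> nat \<Rightarrow> real ^ 'd"
  assumes "T \<ge> 1"
    and "sstar \<in> trajectories T"
    and "sstar 1 = f 1 s0"
    and "\<forall>t\<in>{2..T}. sstar t = f t (sstar (t - 1))"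
    and "\<A> \<in> trajectories T \<rightarrow> trajectories T"
    and "\<forall>x\<in>trajectories T. \<exists>At. linear_recursion T f s0 At x (\<A> x)"
    and "s 0 \<in> trajectories T"
    and "\<forall>i. s (Suc i) = \<A> (s i)"
  shows "\<forall>i\<ge>T. s i = sstar"
proof (intro allI impI)
  fix i assume "T \<le> i"
  have star: "sstar t = f t (with_init s0 sstar (t - 1))" if "t \<in> {1..T}" for t
    using that assms(3,4) by (cases "t = 1") (auto simp: with_init_def)
  have traj: "s j \<in> trajectories T" for j
    by (induction j) (use assms(5,7,8) in auto)
  have exact: "with_init s0 (s j) t = with_init s0 sstar t" if "t \<le> j" "t \<le> T" for j t
    using that
  proof (induction j arbitrary: t)
    case 0
    then show ?case by (simp add: with_init_def)
  next
    case (Suc j)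
    obtain At where "linear_recursion T f s0 At (s j) (s (Suc j))"
      using assms(6,8) traj by metis
    from linear_recursion_extends_exact_prefix[OF this star Suc.IH Suc.prems]
    show ?case .
  qed
  show "s i = sstar"
  proof (rule PiE_ext)
    show "s i \<in> {1..T} \<rightarrow>\<^sub>E UNIV" "sstar \<in> {1..T} \<rightarrow>\<^sub>E UNIV"
      using traj assms(2) unfolding trajectories_def by auto
    show "s i t = sstar t" if "t \<in> {1..T}" for t
      using exact[of t i] that \<open>T \<le> i\<close> by (simp add: with_init_def)
  qed
qed

end
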